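(* For every non-decreasing function $\omega:[0,1]\to[0,\infty)$ and every convex body $K\subset\mathbb{R}^n$, $$\int_0^1 \omega(\delta)\,|C_\delta K|_n\, d\delta \;\le\; \int_0^1 \omega(\delta)\,|C_\delta B_K|_n\, d\delta .$$
   Context: A convex body in $\mathbb{R}^n$ is a compact convex set with non-empty interior. $|\cdot|_n$ denotes $n$-dimensional Lebesgue measure. For a convex body $K$ and $\delta\in(0,1)$, the $\delta$-convolution body of $K$ is $C_\delta K=\{x\in\mathbb{R}^n : |K\cap(K+x)|_n\ge \delta |K|_n\}$. $B_K$ denotes the Euclidean ball centered at the origin with the same volume as $K$. *)

theory Defs
  imports "HOL-Analysis.Analysis"
begin

definition convex_body :: "(real ^ 'n) set \<Rightarrow> bool" where
  "convex_body K \<longleftrightarrow> compact K \<and> convex K \<and> interior K \<noteq> {}"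

text \<open>Meant for \<open>0 < \<delta> < 1\<close>, although the formula makes sense for every real \<open>\<delta>\<close>
  (for \<open>\<delta> = 0\<close> it gives the whole space).\<close>

definition convolution_body :: "real \<Rightarrow> (real ^ 'n) set \<Rightarrow> (real ^ 'n) set" where
  "convolution_body \<delta> K =
     {x. measure lebesgue (K \<inter> (\<lambda>y. y + x) ` K) \<ge> \<delta> * measure lebesgue K}"

definition volume_ball :: "(real ^ 'n) set \<Rightarrow> (real ^ 'n) set" where
  "volume_ball K =
     (THE B. \<exists>r\<ge>0. B = cball 0 r \<and> emeasure lebesgue B = emeasure lebesgue K)"

text \<open>The description is proper whenever \<open>K\<close> has finite volume, in particular for convex bodies.\<close>

lemma volume_ball_unique:
  fixes K :: "(real ^ 'n) set"
  assumes "emeasure lebesgue K < \<infinity>"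
  shows "\<exists>!B. \<exists>r\<ge>0. B = cball (0 :: real ^ 'n) r \<and> emeasure lebesgue B = emeasure lebesgue K"
proof -
  let ?n = "DIM(real ^ 'n)"
  let ?v = "unit_ball_vol (real ?n)"
  have v: "?v > 0" by simp
  have n: "?n > 0" by (rule DIM_positive)
  have em: "emeasure lebesgue (cball (0 :: real ^ 'n) r) = ennreal (?v * r ^ ?n)" if "r \<ge> 0" for r
    using that by (simp add: emeasure_cball)
  have K: "emeasure lebesgue K = ennreal (measure lebesgue K)"
    using assms by (intro emeasure_eq_ennreal_measure) auto
  define s where "s = root ?n (measure lebesgue K / ?v)"
  have s0: "s \<ge> 0" unfolding s_def using v n by (intro real_root_ge_zero divide_nonneg_pos) auto
  have "s ^ ?n = measure lebesgue K / ?v"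
    unfolding s_def using v n by (intro real_root_pow_pos2 divide_nonneg_pos) auto
  then have s1: "?v * s ^ ?n = measure lebesgue K"
    using less_imp_neq[OF v] by (simp del: DIM_cart unit_ball_vol_pos)
  show ?thesis
  proof (rule ex1I[of _ "cball 0 s"])
    show "\<exists>r\<ge>0. cball (0 :: real ^ 'n) s = cball 0 r \<and>
        emeasure lebesgue (cball (0 :: real ^ 'n) s) = emeasure lebesgue K"
      using s0 s1 em[OF s0] K by auto
  next
    fix B :: "(real ^ 'n) set"
    assume "\<exists>r\<ge>0. B = cball 0 r \<and> emeasure lebesgue B = emeasure lebesgue K"
    then obtain r where r: "r \<ge> 0" "B = cball 0 r" "emeasure lebesgue B = emeasure lebesgue K"
      by blast
    have "ennreal (?v * r ^ ?n) = ennreal (?v * s ^ ?n)"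
      using em[OF r(1)] r K s1 by metis
    then have "?v * r ^ ?n = ?v * s ^ ?n"
      using r(1) s0 v by (subst (asm) ennreal_inj) auto
    then have "r ^ ?n = s ^ ?n" using less_imp_neq[OF v] mult_left_cancel by metis
    then have "r = s" using r(1) s0 n by (metis power_eq_imp_eq_base)
    then show "B = cball 0 s" using r by simp
  qed
qed

end

theory Submission
  imports Defs
begin

text \<open>
  Write \<open>g\<close> for the covariogram \<open>x \<mapsto> \<bar>K \<inter> (K + x)\<bar>\<close>, so that \<open>C\<^sub>\<delta> K\<close> is the superlevel set
  \<open>{g \<ge> \<delta> \<bar>K\<bar>}\<close>. A non-decreasing weight is a superposition of indicators of intervals
  \<open>{s..1}\<close>, and by Tonelli the integral of \<open>\<bar>C\<^sub>\<delta> K\<bar>\<close> over \<open>\<delta> \<in> {s..1}\<close> is a multiple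
  of the integral of the positive part of \<open>g - s \<bar>K\<bar>\<close>, called the excess below. The theorem
  therefore says that, among compact convex sets of given volume, the ball has the largest excess at every
  level (\<open>excess_le_cball\<close>). This is a case of the Riesz rearrangement inequality; convexity
  of \<open>K\<close> allows the following direct proof by Steiner symmetrization.

  Steiner symmetrization does not decrease the excess (\<open>excess_le_steiner\<close>). On a line parallel
  to the direction of symmetrization, \<open>g\<close> is a superposition of correlations of two intervals, each
  symmetric and decreasing about some centre; symmetrization keeps their shapes and moves all of them to a common
  centre, and the one-dimensional bathtub principle applies.

  Suitable symmetrizations approach the ball \<open>B\<close> of the same volume. The average over shifts \<open>z\<close> of
  the volume of \<open>(K - B) \<inter> ((B - K) + z)\<close> is proportional to \<open>\<bar>K - B\<bar> \<bar>B - K\<bar>\<close>. A shift with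
  a large value gives a direction in which symmetrization increases \<open>\<bar>K \<inter> B\<bar>\<close> by at least a constant
  multiple of \<open>\<bar>K - B\<bar>\<^sup>2\<close> (\<open>exists_steiner_gain\<close>). So the supremum of \<open>\<bar>L \<inter> B\<bar>\<close> over the
  compact convex sets \<open>L\<close> in a fixed large ball that have the volume and at least the excess of \<open>K\<close> is
  \<open>\<bar>B\<bar>\<close>, and the excess is continuous with respect to the volume of the
  difference (\<open>excess_le_add_diff\<close>).
\<close>

section \<open>Integration along parallel lines\<close>

lemma nn_integral_translate:
  fixes f :: "'a::euclidean_space \<Rightarrow> ennreal"
  assumes [measurable]: "f \<in> borel_measurable borel"
  shows "(\<integral>\<^sup>+x. f (x + c) \<partial>lborel) = (\<integral>\<^sup>+x. f x \<partial>lborel)"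
proof -
  have "(\<integral>\<^sup>+x. f x \<partial>lborel) = (\<integral>\<^sup>+x. f x \<partial>distr lborel borel ((+) c))"
    by (simp add: lborel_distr_plus)
  also have "\<dots> = (\<integral>\<^sup>+x. f (c + x) \<partial>lborel)"
    by (subst nn_integral_distr) auto
  finally show ?thesis by (simp add: add.commute)
qed

text \<open>Fubini's theorem along the lines of direction \<open>u\<close> without choosing coordinates on the
  orthogonal complement of \<open>u\<close>: the outer variable ranges over the slab
  \<open>0 \<le> x \<bullet> u \<le> 1\<close>, which meets every such line in a segment of length 1.\<close>

lemma nn_integral_along_lines:
  fixes f :: "'a::euclidean_space \<Rightarrow> ennreal"
  assumes [measurable]: "f \<in> borel_measurable borel" and u: "norm u = 1"
  shows "(\<integral>\<^sup>+x. f x \<partial>lborel) =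
    (\<integral>\<^sup>+x. indicator {0..1} (x \<bullet> u) * (\<integral>\<^sup>+t. f (x + t *\<^sub>R u) \<partial>lborel) \<partial>lborel)"
proof -
  have uu: "u \<bullet> u = 1" using u by (simp add: norm_eq_1)
  have "(\<integral>\<^sup>+x. indicator {0..1} (x \<bullet> u) * (\<integral>\<^sup>+t. f (x + t *\<^sub>R u) \<partial>lborel) \<partial>lborel)
      = (\<integral>\<^sup>+x. \<integral>\<^sup>+t. indicator {0..1::real} (x \<bullet> u) * f (x + t *\<^sub>R u) \<partial>lborel \<partial>lborel)"
    by (intro nn_integral_cong nn_integral_cmult[symmetric]) measurable
  also have "\<dots> = (\<integral>\<^sup>+t. \<integral>\<^sup>+x. indicator {0..1::real} (x \<bullet> u) * f (x + t *\<^sub>R u) \<partial>lborel \<partial>lborel)"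
    by (rule lborel_pair.Fubini'[symmetric]) measurable
  also have "\<dots> = (\<integral>\<^sup>+t. \<integral>\<^sup>+x. indicator {0..1::real} (x \<bullet> u - t) * f x \<partial>lborel \<partial>lborel)"
  proof (rule nn_integral_cong)
    fix t :: real
    have "(\<integral>\<^sup>+x. indicator {0..1::real} (x \<bullet> u - t) * f x \<partial>lborel)
      = (\<integral>\<^sup>+x. indicator {0..1::real} ((x + t *\<^sub>R u) \<bullet> u - t) * f (x + t *\<^sub>R u) \<partial>lborel)"
      by (rule nn_integral_translate[symmetric]) measurable
    then show "(\<integral>\<^sup>+x. indicator {0..1::real} (x \<bullet> u) * f (x + t *\<^sub>R u) \<partial>lborel)
      = (\<integral>\<^sup>+x. indicator {0..1::real} (x \<bullet> u - t) * f x \<partial>lborel)"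
      by (simp add: inner_add_left uu)
  qed
  also have "\<dots> = (\<integral>\<^sup>+x. \<integral>\<^sup>+t. indicator {0..1::real} (x \<bullet> u - t) * f x \<partial>lborel \<partial>lborel)"
    by (rule lborel_pair.Fubini'[symmetric]) measurable
  also have "\<dots> = (\<integral>\<^sup>+x. \<integral>\<^sup>+t. f x * indicator {x \<bullet> u - 1..x \<bullet> u} t \<partial>lborel \<partial>lborel)"
    by (intro nn_integral_cong) (auto simp: indicator_def)
  also have "\<dots> = (\<integral>\<^sup>+x. f x \<partial>lborel)"
    by (intro nn_integral_cong) (simp add: nn_integral_cmult_indicator)
  finally show ?thesis by simp
qed

lemma nn_integral_mono_along_lines:
  fixes f g :: "'a::euclidean_space \<Rightarrow> ennreal"
  assumes [measurable]: "f \<in> borel_measurable borel" "g \<in> borel_measurable borel"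
    and u: "norm u = 1"
    and le: "\<And>x. (\<integral>\<^sup>+t. f (x + t *\<^sub>R u) \<partial>lborel) \<le> (\<integral>\<^sup>+t. g (x + t *\<^sub>R u) \<partial>lborel)"
  shows "(\<integral>\<^sup>+x. f x \<partial>lborel) \<le> (\<integral>\<^sup>+x. g x \<partial>lborel)"
  unfolding nn_integral_along_lines[OF assms(1) u] nn_integral_along_lines[OF assms(2) u]
  by (intro nn_integral_mono mult_left_mono le) auto

section \<open>Overlap of intervals and the bathtub principle\<close>

text \<open>The length of the intersection of two intervals with half-lengths \<open>k\<close> and \<open>l\<close> whose
  midpoints differ by \<open>t\<close>. A negative half-length stands for the empty interval; then the
  argument of \<open>ennreal\<close> is negative and the value is 0.\<close>

definition overlap :: "real \<Rightarrow> real \<Rightarrow> real \<Rightarrow> ennreal" where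
  "overlap k l t = ennreal (min (min (2 * k) (2 * l)) (k + l - \<bar>t\<bar>))"

lemma measurable_overlap [measurable]: "overlap k l \<in> borel_measurable borel"
  unfolding overlap_def[abs_def] by measurable

lemma overlap_antimono: "\<bar>s\<bar> \<le> \<bar>t\<bar> \<Longrightarrow> overlap k l t \<le> overlap k l s"
  unfolding overlap_def by (intro ennreal_leI min.mono) auto

lemma emeasure_lborel_Icc_ennreal: "emeasure lborel {a..b} = ennreal (b - a)"
  unfolding emeasure_lborel_Icc_eq by (simp add: ennreal_neg)

lemma emeasure_interval_Int:
  "emeasure lborel ({m - k..m + k} \<inter> {n - l..n + l}) = overlap k l (n - m)"
proof -
  have "{m - k..m + k} \<inter> {n - l..n + l} = {max (m - k) (n - l)..min (m + k) (n + l)}" by auto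
  then have "emeasure lborel ({m - k..m + k} \<inter> {n - l..n + l})
      = ennreal (min (m + k) (n + l) - max (m - k) (n - l))"
    by (simp add: emeasure_lborel_Icc_ennreal)
  also have "min (m + k) (n + l) - max (m - k) (n - l)
      = min (min (2 * k) (2 * l)) (k + l - \<bar>n - m\<bar>)"
    by (simp add: min_def max_def abs_if)
  finally show ?thesis by (simp add: overlap_def)
qed

text \<open>Among the sets of given length, the interval centred at 0 gives the largest
  integral of a function that is even and decreasing away from 0.\<close>

lemma bathtub:
  fixes h :: "real \<Rightarrow> ennreal"
  assumes [measurable]: "h \<in> borel_measurable borel"
    and anti: "\<And>s t. \<bar>s\<bar> \<le> \<bar>t\<bar> \<Longrightarrow> h t \<le> h s"
    and A[measurable]: "A \<in> sets borel" and m: "emeasure lborel A = ennreal m" "0 \<le> m"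
  shows "(\<integral>\<^sup>+t. indicator A t * h t \<partial>lborel) \<le> (\<integral>\<^sup>+t. indicator {-m/2..m/2} t * h t \<partial>lborel)"
proof -
  define M where "M = {-m/2..m/2}"
  have [measurable]: "M \<in> sets borel" by (simp add: M_def)
  have out: "h t \<le> h (m/2)" if "t \<notin> M" for t
    using that m(2) by (intro anti) (auto simp: M_def)
  have inside: "h (m/2) \<le> h t" if "t \<in> M" for t
    using that m(2) by (intro anti) (auto simp: M_def)
  have M: "emeasure lborel M = ennreal m" using m(2) by (simp add: M_def)
  have AM: "emeasure lborel (A \<inter> M) + emeasure lborel (A - M) = ennreal m"
    using plus_emeasure[of "A \<inter> M" lborel "A - M"] m by (auto simp: Int_Diff_Un)
  have MA: "emeasure lborel (A \<inter> M) + emeasure lborel (M - A) = ennreal m"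
    using plus_emeasure[of "M \<inter> A" lborel "M - A"] M
    unfolding Int_commute[of A M] by (auto simp: Int_Diff_Un)
  have fin: "emeasure lborel (A \<inter> M) \<noteq> top"
    using AM by (intro notI) simp
  have eq: "emeasure lborel (A - M) = emeasure lborel (M - A)"
    using fin AM[folded MA] by (simp add: ennreal_add_left_cancel)
  have "(\<integral>\<^sup>+t. indicator A t * h t \<partial>lborel)
      = (\<integral>\<^sup>+t. indicator (A \<inter> M) t * h t + indicator (A - M) t * h t \<partial>lborel)"
    by (intro nn_integral_cong) (auto simp: indicator_def)
  also have "\<dots> \<le> (\<integral>\<^sup>+t. indicator (A \<inter> M) t * h t + h (m/2) * indicator (A - M) t \<partial>lborel)"
    by (intro nn_integral_mono) (auto simp: indicator_def out)
  also have "\<dots> = (\<integral>\<^sup>+t. indicator (A \<inter> M) t * h t \<partial>lborel) + h (m/2) * emeasure lborel (A - M)"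
    by (subst nn_integral_add) (auto simp: nn_integral_cmult_indicator)
  also have "\<dots> = (\<integral>\<^sup>+t. indicator (A \<inter> M) t * h t + h (m/2) * indicator (M - A) t \<partial>lborel)"
    unfolding eq by (subst nn_integral_add) (auto simp: nn_integral_cmult_indicator)
  also have "\<dots> \<le> (\<integral>\<^sup>+t. indicator M t * h t \<partial>lborel)"
    by (intro nn_integral_mono) (auto simp: indicator_def inside)
  finally show ?thesis by (simp add: M_def)
qed

lemma bathtub_translated:
  fixes h :: "real \<Rightarrow> ennreal"
  assumes [measurable]: "h \<in> borel_measurable borel"
    and anti: "\<And>s t. \<bar>s\<bar> \<le> \<bar>t\<bar> \<Longrightarrow> h t \<le> h s"
    and A[measurable]: "A \<in> sets borel" and m: "emeasure lborel A = ennreal m" "0 \<le> m"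
  shows "(\<integral>\<^sup>+t. indicator A t * h (t + a) \<partial>lborel)
    \<le> (\<integral>\<^sup>+t. indicator {-b - m/2..-b + m/2} t * h (t + b) \<partial>lborel)"
proof -
  define A' where "A' = {t. t - a \<in> A}"
  have [measurable]: "A' \<in> sets borel" unfolding A'_def by measurable
  have "emeasure lborel A' = (\<integral>\<^sup>+t. indicator A' (t + a) \<partial>lborel)"
    by (subst nn_integral_translate) auto
  also have "\<dots> = (\<integral>\<^sup>+t. indicator A t \<partial>lborel)"
    by (intro nn_integral_cong) (auto simp: A'_def indicator_def)
  finally have A': "emeasure lborel A' = ennreal m" using m by simp
  have "(\<integral>\<^sup>+t. indicator A t * h (t + a) \<partial>lborel)
      = (\<integral>\<^sup>+t. indicator A' (t + a) * h (t + a) \<partial>lborel)"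
    by (intro nn_integral_cong) (auto simp: A'_def indicator_def)
  also have "\<dots> = (\<integral>\<^sup>+t. indicator A' t * h t \<partial>lborel)"
    by (rule nn_integral_translate) measurable
  also have "\<dots> \<le> (\<integral>\<^sup>+t. indicator {-m/2..m/2} t * h t \<partial>lborel)"
    by (rule bathtub[OF _ anti _ A' m(2)]) auto
  also have "\<dots> = (\<integral>\<^sup>+t. indicator {-m/2..m/2} (t + b) * h (t + b) \<partial>lborel)"
    by (rule nn_integral_translate[symmetric]) measurable
  also have "\<dots> = (\<integral>\<^sup>+t. indicator {-b - m/2..-b + m/2} t * h (t + b) \<partial>lborel)"
    by (intro nn_integral_cong) (auto simp: indicator_def)
  finally show ?thesis .
qed

section \<open>Correlation of two sets\<close>

text \<open>The volume of \<open>{y \<in> Q. y + z \<in> P}\<close>, that is of \<open>P \<inter> (Q + z)\<close>. For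
  \<open>P = Q = K\<close> this is the covariogram of \<open>K\<close>, whose superlevel sets are the
  convolution bodies.\<close>

definition correlation :: "'a::euclidean_space set \<Rightarrow> 'a set \<Rightarrow> 'a \<Rightarrow> ennreal" where
  "correlation P Q z = (\<integral>\<^sup>+y. indicator P (y + z) * indicator Q y \<partial>lborel)"

lemma measurable_correlation [measurable]:
  assumes [measurable]: "P \<in> sets borel" "Q \<in> sets borel"
  shows "correlation P Q \<in> borel_measurable borel"
  unfolding correlation_def by measurable

lemma correlation_eq_emeasure:
  assumes [measurable]: "P \<in> sets borel" "Q \<in> sets borel"
  shows "correlation P Q z = emeasure lborel {y \<in> Q. y + z \<in> P}"
proof -
  have "{y \<in> Q. y + z \<in> P} = {y. y \<in> Q \<and> y + z \<in> P}" by auto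
  moreover have "\<dots> \<in> sets borel" by measurable
  ultimately have "emeasure lborel {y \<in> Q. y + z \<in> P} = (\<integral>\<^sup>+y. indicator {y \<in> Q. y + z \<in> P} y \<partial>lborel)"
    by simp
  also have "\<dots> = correlation P Q z"
    unfolding correlation_def by (intro nn_integral_cong) (auto simp: indicator_def)
  finally show ?thesis ..
qed

lemma nn_integral_correlation:
  assumes [measurable]: "P \<in> sets borel" "Q \<in> sets borel"
  shows "(\<integral>\<^sup>+z. correlation P Q z \<partial>lborel) = emeasure lborel P * emeasure lborel Q"
proof -
  have "(\<integral>\<^sup>+z. correlation P Q z \<partial>lborel)
      = (\<integral>\<^sup>+y. \<integral>\<^sup>+z. indicator P (z + y) * indicator Q y \<partial>lborel \<partial>lborel)"
    unfolding correlation_def by (subst lborel_pair.Fubini'[symmetric]) (auto simp: add.commute)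
  also have "\<dots> = (\<integral>\<^sup>+y. emeasure lborel P * indicator Q y \<partial>lborel)"
    by (intro nn_integral_cong) (simp add: nn_integral_multc nn_integral_translate)
  finally show ?thesis by (simp add: nn_integral_cmult_indicator)
qed

section \<open>Steiner symmetrization\<close>

text \<open>Slices are parametrised by the multiple of \<open>u\<close> added to a base point \<open>x\<close>, and written as
  intervals with midpoint \<open>m\<close> and half-length \<open>k\<close>; an empty slice has \<open>k < 0\<close>.\<close>

lemma compact_convex_slice:
  fixes K :: "'a::euclidean_space set"
  assumes K: "compact K" "convex K" and u: "norm u = 1"
  obtains m k where "{t. x + t *\<^sub>R u \<in> K} = {m - k..m + k}"
proof -
  let ?T = "{t. x + t *\<^sub>R u \<in> K}"
  have uu: "u \<bullet> u = 1" using u by (simp add: norm_eq_1)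
  have "convex ?T"
  proof (rule convexI)
    fix s t a b :: real
    assume *: "s \<in> ?T" "t \<in> ?T" "0 \<le> a" "0 \<le> b" "a + b = 1"
    have "x + (a *\<^sub>R s + b *\<^sub>R t) *\<^sub>R u = (a + b) *\<^sub>R x + (a *\<^sub>R s + b *\<^sub>R t) *\<^sub>R u"
      using * by simp
    also have "\<dots> = a *\<^sub>R (x + s *\<^sub>R u) + b *\<^sub>R (x + t *\<^sub>R u)"
      by (simp add: algebra_simps)
    also have "\<dots> \<in> K" using * K(2) by (intro convexD) auto
    finally show "a *\<^sub>R s + b *\<^sub>R t \<in> ?T" by simp
  qed
  moreover have "compact ?T"
  proof -
    have "?T \<subseteq> (\<lambda>y. (y - x) \<bullet> u) ` K"
    proof
      fix t assume "t \<in> ?T"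
      then show "t \<in> (\<lambda>y. (y - x) \<bullet> u) ` K"
        by (intro image_eqI[of _ _ "x + t *\<^sub>R u"]) (auto simp: uu)
    qed
    moreover have "bounded ((\<lambda>y. (y - x) \<bullet> u) ` K)"
      by (intro compact_imp_bounded compact_continuous_image continuous_intros K)
    moreover have "closed ((\<lambda>t. x + t *\<^sub>R u) -` K)"
      by (intro closed_vimage compact_imp_closed K continuous_intros)
    ultimately show ?thesis
      by (auto simp: compact_eq_bounded_closed vimage_def intro: bounded_subset)
  qed
  ultimately obtain a b where ab: "?T = {a..b}"
    using connected_compact_interval_1 convex_connected by blast
  have "{a..b} = {(a+b)/2 - (b-a)/2..(a+b)/2 + (b-a)/2}" by (auto simp: field_simps)
  with ab that show ?thesis by metis
qed

text \<open>Steiner symmetrization of a compact convex set with respect to the hyperplane through 0 orthogonal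
  to the unit vector \<open>u\<close>. A nonempty slice of a compact convex \<open>K\<close> through \<open>x\<close> has length at
  least \<open>2 * \<bar>x \<bullet> u\<bar>\<close> iff it contains two points at least that far apart; phrasing the
  condition by two such points exhibits the symmetrization as a linear projection of a set that
  inherits compactness and convexity from \<open>K\<close>.\<close>

definition steiner :: "'a::euclidean_space \<Rightarrow> 'a set \<Rightarrow> 'a set" where
  "steiner u K = {x. \<exists>a b. x + a *\<^sub>R u \<in> K \<and> x + b *\<^sub>R u \<in> K \<and> 2 * \<bar>x \<bullet> u\<bar> \<le> b - a}"

lemma steiner_mono: "K \<subseteq> L \<Longrightarrow> steiner u K \<subseteq> steiner u L"
  unfolding steiner_def by blast

lemma slice_steiner:
  assumes u: "norm u = 1" and K: "{t. x + t *\<^sub>R u \<in> K} = {m - k..m + k}"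
  shows "{t. x + t *\<^sub>R u \<in> steiner u K} = {-(x \<bullet> u) - k..-(x \<bullet> u) + k}"
proof -
  have uu: "u \<bullet> u = 1" using u by (simp add: norm_eq_1)
  have K': "x + t *\<^sub>R u \<in> K \<longleftrightarrow> m - k \<le> t \<and> t \<le> m + k" for t using K by auto
  have shift: "x + t *\<^sub>R u + a *\<^sub>R u = x + (t + a) *\<^sub>R u" for t a by (simp add: algebra_simps)
  define e where "e = x \<bullet> u"
  have "x + t *\<^sub>R u \<in> steiner u K \<longleftrightarrow>
      (\<exists>a b. m - k \<le> t + a \<and> t + a \<le> m + k \<and> m - k \<le> t + b \<and> t + b \<le> m + k \<and> 2 * \<bar>e + t\<bar> \<le> b - a)" (is "_ \<longleftrightarrow> ?P t") for t
    unfolding steiner_def mem_Collect_eq shift K' inner_add_left inner_scaleR_left uu e_def by simp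
  moreover have "?P t \<longleftrightarrow> -e - k \<le> t \<and> t \<le> -e + k" for t
  proof
    assume "\<exists>a b. m - k \<le> t + a \<and> t + a \<le> m + k \<and> m - k \<le> t + b \<and> t + b \<le> m + k \<and> 2 * \<bar>e + t\<bar> \<le> b - a"
    then obtain a b where "m - k \<le> t + a" "t + b \<le> m + k" "2 * \<bar>e + t\<bar> \<le> b - a" by blast
    then have "\<bar>e + t\<bar> \<le> k" by argo
    then show "-e - k \<le> t \<and> t \<le> -e + k" by (simp add: abs_le_iff)
  next
    assume "-e - k \<le> t \<and> t \<le> -e + k"
    then have "\<bar>e + t\<bar> \<le> k" by (auto simp: abs_le_iff)
    moreover from this have "0 \<le> k" using abs_ge_zero order_trans by blast
    ultimately have "m - k \<le> t + (m - k - t) \<and> t + (m - k - t) \<le> m + k \<and> m - k \<le> t + (m + k - t)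
        \<and> t + (m + k - t) \<le> m + k \<and> 2 * \<bar>e + t\<bar> \<le> (m + k - t) - (m - k - t)"
      by simp
    then show "?P t" by blast
  qed
  ultimately show ?thesis
    unfolding set_eq_iff mem_Collect_eq atLeastAtMost_iff e_def by blast
qed

lemma slice_cball:
  fixes x u :: "'a::euclidean_space"
  assumes u: "norm u = 1"
  obtains k where "{t. x + t *\<^sub>R u \<in> cball 0 r} = {-(x \<bullet> u) - k..-(x \<bullet> u) + k}"
proof -
  have uu: "u \<bullet> u = 1" using u by (simp add: norm_eq_1)
  define e where "e = x \<bullet> u"
  define q where "q = r\<^sup>2 - x \<bullet> x + e\<^sup>2"
  define k where "k = (if 0 \<le> r \<and> 0 \<le> q then sqrt q else -1)"
  have *: "(x + t *\<^sub>R u) \<bullet> (x + t *\<^sub>R u) = x \<bullet> x - e\<^sup>2 + (t + e)\<^sup>2" for t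
    unfolding e_def
    by (simp add: uu inner_add_left inner_add_right inner_commute power2_eq_square algebra_simps)
  have "x + t *\<^sub>R u \<in> cball 0 r \<longleftrightarrow> 0 \<le> r \<and> (t + e)\<^sup>2 \<le> q" for t
    unfolding mem_cball_0 norm_le_square * q_def by auto
  moreover have "0 \<le> r \<and> (t + e)\<^sup>2 \<le> q \<longleftrightarrow> \<bar>t + e\<bar> \<le> k" for t
  proof (cases "0 \<le> r \<and> 0 \<le> q")
    case True
    then show ?thesis
      unfolding k_def using abs_le_square_iff[of "t + e" "sqrt q"] by simp
  next
    case False
    then have "\<not> (0 \<le> r \<and> (t + e)\<^sup>2 \<le> q)" "k = -1"
      using order_trans[OF zero_le_power2] by (auto simp: k_def)
    then show ?thesis by linarith
  qed
  moreover have "\<bar>t + e\<bar> \<le> k \<longleftrightarrow> -e - k \<le> t \<and> t \<le> -e + k" for t by linarith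
  ultimately have "{t. x + t *\<^sub>R u \<in> cball 0 r} = {-e - k..-e + k}"
    by (simp only: set_eq_iff mem_Collect_eq atLeastAtMost_iff simp_thms)
  with that show ?thesis unfolding e_def .
qed

lemma steiner_cball:
  fixes u :: "'a::euclidean_space"
  assumes u: "norm u = 1" shows "steiner u (cball 0 r) = cball 0 r"
proof (rule set_eqI)
  fix x :: 'a
  obtain k where k: "{t. x + t *\<^sub>R u \<in> cball 0 r} = {-(x \<bullet> u) - k..-(x \<bullet> u) + k}"
    using slice_cball[OF u] .
  have "0 \<in> {t. x + t *\<^sub>R u \<in> steiner u (cball 0 r)} \<longleftrightarrow> 0 \<in> {t. x + t *\<^sub>R u \<in> cball 0 r}"
    unfolding slice_steiner[OF u k] k ..
  then show "x \<in> steiner u (cball 0 r) \<longleftrightarrow> x \<in> cball 0 r" by simp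
qed

lemma convex_steiner:
  assumes "convex K" shows "convex (steiner u K)"
proof (rule convexI)
  fix x y s t assume xy: "x \<in> steiner u K" "y \<in> steiner u K" and st: "0 \<le> s" "0 \<le> t" "s + t = (1::real)"
  obtain a b where ab: "x + a *\<^sub>R u \<in> K" "x + b *\<^sub>R u \<in> K" "2 * \<bar>x \<bullet> u\<bar> \<le> b - a"
    using xy(1) by (auto simp: steiner_def)
  obtain c d where cd: "y + c *\<^sub>R u \<in> K" "y + d *\<^sub>R u \<in> K" "2 * \<bar>y \<bullet> u\<bar> \<le> d - c"
    using xy(2) by (auto simp: steiner_def)
  have "s *\<^sub>R x + t *\<^sub>R y + (s * a + t * c) *\<^sub>R u = s *\<^sub>R (x + a *\<^sub>R u) + t *\<^sub>R (y + c *\<^sub>R u)"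
    by (simp add: algebra_simps)
  also have "\<dots> \<in> K" using ab cd st assms by (intro convexD) auto
  finally have 1: "s *\<^sub>R x + t *\<^sub>R y + (s * a + t * c) *\<^sub>R u \<in> K" .
  have "s *\<^sub>R x + t *\<^sub>R y + (s * b + t * d) *\<^sub>R u = s *\<^sub>R (x + b *\<^sub>R u) + t *\<^sub>R (y + d *\<^sub>R u)"
    by (simp add: algebra_simps)
  also have "\<dots> \<in> K" using ab cd st assms by (intro convexD) auto
  finally have 2: "s *\<^sub>R x + t *\<^sub>R y + (s * b + t * d) *\<^sub>R u \<in> K" .
  have "2 * \<bar>s * (x \<bullet> u) + t * (y \<bullet> u)\<bar> \<le> 2 * (\<bar>s * (x \<bullet> u)\<bar> + \<bar>t * (y \<bullet> u)\<bar>)"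
    by (intro mult_left_mono abs_triangle_ineq) auto
  also have "\<dots> = s * (2 * \<bar>x \<bullet> u\<bar>) + t * (2 * \<bar>y \<bullet> u\<bar>)" using st by (simp add: abs_mult)
  also have "\<dots> \<le> s * (b - a) + t * (d - c)" using st ab cd by (intro add_mono mult_left_mono) auto
  finally have 3: "2 * \<bar>(s *\<^sub>R x + t *\<^sub>R y) \<bullet> u\<bar> \<le> (s * b + t * d) - (s * a + t * c)"
    by (simp add: inner_add_left algebra_simps)
  show "s *\<^sub>R x + t *\<^sub>R y \<in> steiner u K"
    unfolding steiner_def using 1 2 3 by blast
qed

lemma compact_steiner:
  fixes K :: "'a::euclidean_space set"
  assumes K: "compact K" and u: "norm u = 1" shows "compact (steiner u K)"
proof -
  obtain R where R: "K \<subseteq> cball 0 R"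
    using compact_imp_bounded[OF K] by (auto simp: bounded_iff subset_iff)
  \<comment> \<open>The symmetrization is the projection of \<open>T\<close> to the first component.\<close>
  define T where "T = {p :: 'a \<times> real \<times> real. fst p + fst (snd p) *\<^sub>R u \<in> K \<and>
      fst p + snd (snd p) *\<^sub>R u \<in> K \<and> 2 * \<bar>fst p \<bullet> u\<bar> \<le> snd (snd p) - fst (snd p)}"
  have T_iff: "x \<in> steiner u K \<longleftrightarrow> (\<exists>a b. (x, a, b) \<in> T)" for x
    by (simp add: steiner_def T_def)
  have eq: "steiner u K = fst ` T"
    by (intro set_eqI) (simp add: T_iff image_iff Bex_def)
  have SR: "steiner u K \<subseteq> cball 0 R" using steiner_mono[OF R, of u] steiner_cball[OF u] by auto
  have "T \<subseteq> cball 0 R \<times> cball 0 (2*R) \<times> cball 0 (2*R)"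
  proof safe
    fix x a b assume T: "(x, a, b) \<in> T"
    then have "x \<in> steiner u K" unfolding T_iff by blast
    with SR show x: "x \<in> cball 0 R" by auto
    have "\<bar>c\<bar> \<le> 2 * R" if "x + c *\<^sub>R u \<in> K" for c
    proof -
      have "\<bar>c\<bar> = norm (c *\<^sub>R u)" using u by simp
      also have "\<dots> \<le> norm (x + c *\<^sub>R u) + norm x"
        using norm_triangle_ineq4[of "x + c *\<^sub>R u" x] by simp
      also have "\<dots> \<le> R + R" using x R that by (intro add_mono) auto
      finally show ?thesis by simp
    qed
    then show "a \<in> cball 0 (2*R)" "b \<in> cball 0 (2*R)" using T by (auto simp: T_def)
  qed
  then have "bounded T"
    by (rule bounded_subset[rotated]) (intro bounded_Times bounded_cball)
  moreover have "closed T"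
  proof -
    have "T = (\<lambda>p. fst p + fst (snd p) *\<^sub>R u) -` K \<inter> (\<lambda>p. fst p + snd (snd p) *\<^sub>R u) -` K
       \<inter> {p. 2 * \<bar>fst p \<bullet> u\<bar> \<le> snd (snd p) - fst (snd p)}" by (auto simp: T_def)
    moreover have "closed \<dots>"
      by (intro closed_Int closed_vimage compact_imp_closed K closed_Collect_le continuous_intros)
    ultimately show ?thesis by simp
  qed
  ultimately have "compact T" by (simp add: compact_eq_bounded_closed)
  then show ?thesis unfolding eq by (intro compact_continuous_image continuous_intros)
qed

lemma emeasure_along_lines:
  fixes A :: "'a::euclidean_space set"
  assumes [measurable]: "A \<in> sets borel"
  shows "(\<integral>\<^sup>+t. indicator A (x + t *\<^sub>R u) \<partial>lborel) = emeasure lborel {t. x + t *\<^sub>R u \<in> A}"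
proof -
  have [measurable]: "{t. x + t *\<^sub>R u \<in> A} \<in> sets borel" by measurable
  have "(\<integral>\<^sup>+t. indicator A (x + t *\<^sub>R u) \<partial>lborel) = (\<integral>\<^sup>+t. indicator {t. x + t *\<^sub>R u \<in> A} t \<partial>lborel)"
    by (intro nn_integral_cong) (auto simp: indicator_def)
  then show ?thesis by simp
qed

lemma emeasure_steiner:
  fixes K :: "'a::euclidean_space set"
  assumes K: "compact K" "convex K" and u: "norm u = 1"
  shows "emeasure lborel (steiner u K) = emeasure lborel K"
proof -
  have [measurable]: "K \<in> sets borel" "steiner u K \<in> sets borel"
    using K compact_steiner[OF K(1) u] by (auto intro: borel_compact)
  have "(\<integral>\<^sup>+t. indicator (steiner u K) (x + t *\<^sub>R u) \<partial>lborel)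
      = (\<integral>\<^sup>+t. indicator K (x + t *\<^sub>R u) \<partial>lborel)" for x
  proof -
    obtain m k where "{t. x + t *\<^sub>R u \<in> K} = {m - k..m + k}" using compact_convex_slice[OF K u] .
    from this slice_steiner[OF u this] show ?thesis
      by (cases "0 \<le> k") (simp_all add: emeasure_along_lines)
  qed
  then show ?thesis
    using nn_integral_along_lines[of "indicator K" u] nn_integral_along_lines[of "indicator (steiner u K)" u] u
    by simp
qed

section \<open>Monotonicity of the covariogram excess\<close>

text \<open>The integral of the part of the covariogram of \<open>K\<close> above level \<open>s\<close>; subtraction of extended
  nonnegative reals truncates at 0, so the integrand is a positive part.\<close>

definition excess :: "ennreal \<Rightarrow> 'a::euclidean_space set \<Rightarrow> ennreal" where
  "excess s K = (\<integral>\<^sup>+z. (correlation K K z - s) \<partial>lborel)"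

lemma correlation_eq_0:
  assumes "P \<subseteq> cball 0 R" "Q \<subseteq> cball 0 R" "2 * R < norm z"
  shows "correlation P Q z = 0"
proof -
  have "indicator P (y + z) * indicator Q y = (0::ennreal)" for y
  proof (rule ccontr)
    assume "\<not> ?thesis"
    then have "norm (y + z) \<le> R" "norm y \<le> R" using assms by (auto simp: indicator_def split: if_splits)
    moreover have "norm z \<le> norm (y + z) + norm y" using norm_triangle_ineq4[of "y + z" y] by simp
    ultimately show False using assms(3) by linarith
  qed
  then show ?thesis unfolding correlation_def by (simp only:) simp
qed

text \<open>On a line of direction \<open>u\<close>, the covariogram is a superposition over \<open>y\<close> of
  one-dimensional correlations of slices of \<open>K\<close>.\<close>

lemma nn_integral_correlation_line:
  fixes K :: "'a::euclidean_space set"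
  assumes [measurable]: "K \<in> sets borel" "w \<in> borel_measurable borel" and u: "norm u = 1"
  shows "(\<integral>\<^sup>+t. w t * correlation K K (z + t *\<^sub>R u) \<partial>lborel) =
    (\<integral>\<^sup>+y. indicator {0..1} (y \<bullet> u) * (\<integral>\<^sup>+t. w t *
       (\<integral>\<^sup>+r. indicator K (y + r *\<^sub>R u + (z + t *\<^sub>R u)) * indicator K (y + r *\<^sub>R u) \<partial>lborel) \<partial>lborel) \<partial>lborel)"
proof -
  define I :: "'a \<Rightarrow> real \<Rightarrow> ennreal" where
    "I y t = (\<integral>\<^sup>+r. indicator K (y + r *\<^sub>R u + (z + t *\<^sub>R u)) * indicator K (y + r *\<^sub>R u) \<partial>lborel)" for y t
  have [measurable]: "case_prod I \<in> borel_measurable (borel \<Otimes>\<^sub>M borel)"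
    unfolding I_def by measurable
  have "correlation K K (z + t *\<^sub>R u) = (\<integral>\<^sup>+y. indicator {0..1} (y \<bullet> u) * I y t \<partial>lborel)" for t
    unfolding correlation_def I_def by (rule nn_integral_along_lines[OF _ u]) measurable
  then have "(\<integral>\<^sup>+t. w t * correlation K K (z + t *\<^sub>R u) \<partial>lborel)
      = (\<integral>\<^sup>+t. \<integral>\<^sup>+y. w t * (indicator {0..1} (y \<bullet> u) * I y t) \<partial>lborel \<partial>lborel)"
    by (simp add: nn_integral_cmult)
  also have "\<dots> = (\<integral>\<^sup>+y. \<integral>\<^sup>+t. w t * (indicator {0..1} (y \<bullet> u) * I y t) \<partial>lborel \<partial>lborel)"
    by (rule lborel_pair.Fubini'[symmetric]) measurable
  also have "\<dots> = (\<integral>\<^sup>+y. \<integral>\<^sup>+t. indicator {0..1} (y \<bullet> u) * (w t * I y t) \<partial>lborel \<partial>lborel)"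
    by (intro nn_integral_cong) (simp add: ac_simps)
  also have "\<dots> = (\<integral>\<^sup>+y. indicator {0..1} (y \<bullet> u) * (\<integral>\<^sup>+t. w t * I y t \<partial>lborel) \<partial>lborel)"
    by (simp add: nn_integral_cmult)
  finally show ?thesis by (simp add: I_def)
qed

lemma line_correlation_eq_overlap:
  fixes K :: "'a::euclidean_space set"
  assumes [measurable]: "K \<in> sets borel"
    and "{t. y + z + t *\<^sub>R u \<in> K} = {m - k..m + k}" "{t. y + t *\<^sub>R u \<in> K} = {n - l..n + l}"
  shows "(\<integral>\<^sup>+r. indicator K (y + r *\<^sub>R u + (z + t *\<^sub>R u)) * indicator K (y + r *\<^sub>R u) \<partial>lborel)
    = overlap k l (t + (n - m))"
proof -
  have shift: "y + r *\<^sub>R u + (z + t *\<^sub>R u) = y + z + (r + t) *\<^sub>R u" for r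
    by (simp add: algebra_simps)
  have "y + r *\<^sub>R u + (z + t *\<^sub>R u) \<in> K \<longleftrightarrow> r + t \<in> {m - k..m + k}" for r
    unfolding shift using assms(2) by blast
  moreover have "r + t \<in> {m - k..m + k} \<longleftrightarrow> r \<in> {(m - t) - k..(m - t) + k}" for r by auto
  moreover have "y + r *\<^sub>R u \<in> K \<longleftrightarrow> r \<in> {n - l..n + l}" for r
    using assms(3) by blast
  ultimately have "indicator K (y + r *\<^sub>R u + (z + t *\<^sub>R u)) * indicator K (y + r *\<^sub>R u)
      = (indicator ({(m - t) - k..(m - t) + k} \<inter> {n - l..n + l}) r :: ennreal)" for r
    by (simp only: indicator_def Int_iff) simp
  then have "(\<integral>\<^sup>+r. indicator K (y + r *\<^sub>R u + (z + t *\<^sub>R u)) * indicator K (y + r *\<^sub>R u) \<partial>lborel)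
      = emeasure lborel ({(m - t) - k..(m - t) + k} \<inter> {n - l..n + l})" by simp
  also have "\<dots> = overlap k l (t + (n - m))"
    unfolding emeasure_interval_Int by (simp add: algebra_simps)
  finally show ?thesis .
qed

text \<open>After symmetrization all the one-dimensional correlations on one line have the same centre
  \<open>-(z \<bullet> u)\<close>. Let \<open>J\<close> be the part of the line where the covariogram of \<open>K\<close> exceeds
  \<open>s\<close>, and \<open>M\<close> the interval of the same length around that centre. By the bathtub principle
  the integral over \<open>J\<close> before symmetrization is at most the integral over \<open>M\<close> after
  it, and subtracting \<open>s\<close> times the common length gives the claim.\<close>

lemma excess_line_le_steiner:
  fixes K :: "'a::euclidean_space set"
  assumes K: "compact K" "convex K" and u: "norm u = 1" and s: "s < top"
  shows "(\<integral>\<^sup>+t. (correlation K K (z + t *\<^sub>R u) - s) \<partial>lborel)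
    \<le> (\<integral>\<^sup>+t. (correlation (steiner u K) (steiner u K) (z + t *\<^sub>R u) - s) \<partial>lborel)"
proof -
  define S where "S = steiner u K"
  have [measurable]: "K \<in> sets borel" "S \<in> sets borel"
    using K compact_steiner[OF K(1) u] by (auto intro: borel_compact simp: S_def)
  define f where "f t = correlation K K (z + t *\<^sub>R u)" for t
  define g where "g t = correlation S S (z + t *\<^sub>R u)" for t
  have [measurable]: "f \<in> borel_measurable borel" "g \<in> borel_measurable borel"
    unfolding f_def g_def by measurable
  define J where "J = {t. s < f t}"
  have J[measurable]: "J \<in> sets borel" unfolding J_def by measurable
  obtain R where R: "K \<subseteq> cball 0 R"
    using compact_imp_bounded[OF K(1)] by (auto simp: bounded_iff subset_iff)
  have "J \<subseteq> {-(2 * R + norm z)..2 * R + norm z}"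
  proof
    fix t assume "t \<in> J"
    then have "f t \<noteq> 0" by (auto simp: J_def)
    then have "norm (z + t *\<^sub>R u) \<le> 2 * R"
      using correlation_eq_0[OF R R] unfolding f_def by force
    moreover have "\<bar>t\<bar> \<le> norm (z + t *\<^sub>R u) + norm z"
      using norm_triangle_ineq4[of "z + t *\<^sub>R u" z] u by simp
    ultimately have "\<bar>t\<bar> \<le> 2 * R + norm z" by linarith
    then show "t \<in> {-(2 * R + norm z)..2 * R + norm z}" by (simp add: abs_le_iff)
  qed
  then have "emeasure lborel J \<le> emeasure lborel {-(2 * R + norm z)..2 * R + norm z}"
    by (intro emeasure_mono) auto
  also have "\<dots> < top" by (simp add: emeasure_lborel_Icc_ennreal)
  finally obtain m where m: "emeasure lborel J = ennreal m" "0 \<le> m"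
    by (cases "emeasure lborel J") auto
  define M where "M = {-(z \<bullet> u) - m/2..-(z \<bullet> u) + m/2}"
  have [measurable]: "M \<in> sets borel" by (simp add: M_def)
  have M: "emeasure lborel M = ennreal m" by (simp add: M_def emeasure_lborel_Icc_ennreal)
  have fg: "(\<integral>\<^sup>+t. indicator J t * f t \<partial>lborel) \<le> (\<integral>\<^sup>+t. indicator M t * g t \<partial>lborel)"
    unfolding f_def g_def
      nn_integral_correlation_line[OF \<open>K \<in> sets borel\<close> borel_measurable_indicator[OF J] u]
      nn_integral_correlation_line[OF \<open>S \<in> sets borel\<close> borel_measurable_indicator[OF \<open>M \<in> sets borel\<close>] u]
  proof (rule nn_integral_mono, rule mult_left_mono)
    fix y :: 'a
    obtain m' k where mk: "{t. y + z + t *\<^sub>R u \<in> K} = {m' - k..m' + k}"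
      using compact_convex_slice[OF K u] .
    obtain n l where nl: "{t. y + t *\<^sub>R u \<in> K} = {n - l..n + l}"
      using compact_convex_slice[OF K u] .
    have S: "(\<integral>\<^sup>+r. indicator S (y + r *\<^sub>R u + (z + t *\<^sub>R u)) * indicator S (y + r *\<^sub>R u) \<partial>lborel)
      = overlap k l (t + z \<bullet> u)" for t
      using line_correlation_eq_overlap[OF \<open>S \<in> sets borel\<close>,
        OF slice_steiner[OF u mk, folded S_def] slice_steiner[OF u nl, folded S_def]]
      by (simp add: inner_add_left)
    show "(\<integral>\<^sup>+t. indicator J t *
       (\<integral>\<^sup>+r. indicator K (y + r *\<^sub>R u + (z + t *\<^sub>R u)) * indicator K (y + r *\<^sub>R u) \<partial>lborel) \<partial>lborel)
      \<le> (\<integral>\<^sup>+t. indicator M t *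
       (\<integral>\<^sup>+r. indicator S (y + r *\<^sub>R u + (z + t *\<^sub>R u)) * indicator S (y + r *\<^sub>R u) \<partial>lborel) \<partial>lborel)"
      unfolding S line_correlation_eq_overlap[OF \<open>K \<in> sets borel\<close> mk nl] M_def
      by (rule bathtub_translated[OF _ overlap_antimono J m]) auto
  qed auto
  have "(\<integral>\<^sup>+t. f t - s \<partial>lborel) + s * ennreal m = (\<integral>\<^sup>+t. (f t - s) + s * indicator J t \<partial>lborel)"
    by (subst nn_integral_add) (auto simp: nn_integral_cmult_indicator m)
  also have "\<dots> = (\<integral>\<^sup>+t. indicator J t * f t \<partial>lborel)"
    by (intro nn_integral_cong)
       (auto simp: J_def indicator_def not_less diff_add_cancel_ennreal
          intro!: diff_eq_0_ennreal le_less_trans[OF _ s])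
  also note fg
  also have "(\<integral>\<^sup>+t. indicator M t * g t \<partial>lborel) \<le> (\<integral>\<^sup>+t. (g t - s) + s * indicator M t \<partial>lborel)"
  proof (rule nn_integral_mono)
    fix t
    have "g t \<le> (g t - s) + s"
      by (cases "g t \<le> s") (auto simp: diff_add_cancel_ennreal add_increasing)
    then show "indicator M t * g t \<le> (g t - s) + s * indicator M t"
      by (auto simp: indicator_def)
  qed
  also have "\<dots> = (\<integral>\<^sup>+t. g t - s \<partial>lborel) + s * ennreal m"
    by (subst nn_integral_add) (auto simp: nn_integral_cmult_indicator M)
  finally have "(\<integral>\<^sup>+t. f t - s \<partial>lborel) + s * ennreal m \<le> (\<integral>\<^sup>+t. g t - s \<partial>lborel) + s * ennreal m" .
  moreover have "s * ennreal m < top" using s by (simp add: ennreal_mult_less_top)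
  ultimately show ?thesis
    unfolding f_def g_def S_def by (auto simp: add.commute[of _ "s * ennreal m"] ennreal_add_left_cancel_le)
qed

lemma excess_le_steiner:
  fixes K :: "'a::euclidean_space set"
  assumes K: "compact K" "convex K" and u: "norm u = 1" and s: "s < top"
  shows "excess s K \<le> excess s (steiner u K)"
proof -
  have [measurable]: "K \<in> sets borel" "steiner u K \<in> sets borel"
    using K compact_steiner[OF K(1) u] by (auto intro: borel_compact)
  show ?thesis unfolding excess_def
    by (intro nn_integral_mono_along_lines[OF _ _ u] excess_line_le_steiner[OF assms]) measurable
qed

text \<open>Continuity of the excess with respect to the volume of the set difference.\<close>

lemma excess_le_add_diff:
  assumes [measurable]: "K \<in> sets borel" "B \<in> sets borel" and s: "s < top"
  shows "excess s K \<le> excess s B + 2 * (emeasure lborel K * emeasure lborel (K - B))"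
proof -
  have "correlation K K z \<le> correlation B B z + (correlation (K - B) K z + correlation K (K - B) z)" for z
  proof -
    have "correlation K K z \<le> (\<integral>\<^sup>+y. indicator B (y + z) * indicator B y +
        (indicator (K - B) (y + z) * indicator K y + indicator K (y + z) * indicator (K - B) y) \<partial>lborel)"
      unfolding correlation_def by (intro nn_integral_mono) (auto simp: indicator_def)
    also have "\<dots> = correlation B B z + (correlation (K - B) K z + correlation K (K - B) z)"
      unfolding correlation_def by (simp add: nn_integral_add)
    finally show ?thesis .
  qed
  moreover have "a - s \<le> (b - s) + c" if "a \<le> b + c" for a b c :: ennreal
  proof -
    have "b \<le> (b - s) + s"
      by (cases "b \<le> s") (auto simp: diff_add_cancel_ennreal add_increasing)
    then have "a \<le> s + ((b - s) + c)"
      using that by (metis add.assoc add.commute add_right_mono order_trans)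
    then show ?thesis using s by (auto simp: ennreal_minus_le_iff)
  qed
  ultimately have "excess s K \<le> (\<integral>\<^sup>+z. (correlation B B z - s) +
      (correlation (K - B) K z + correlation K (K - B) z) \<partial>lborel)"
    unfolding excess_def by (intro nn_integral_mono) blast
  also have "\<dots> = excess s B + (emeasure lborel (K - B) * emeasure lborel K
      + emeasure lborel K * emeasure lborel (K - B))"
    unfolding excess_def by (simp add: nn_integral_add nn_integral_correlation)
  finally show ?thesis by (simp add: mult_2 mult.commute)
qed

text \<open>The gain in overlap with a centred ball \<open>B\<close>. On each line the symmetrized slice and the
  slice of \<open>B\<close> are concentric, so they meet in the shorter of the two. Both the slice of \<open>K\<close> and
  the slice of \<open>B\<close> are at least as long as those of \<open>K \<inter> B\<close> and \<open>G\<close> together, where \<open>G\<close> is the set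
  of points of \<open>B - K\<close> that a shift by \<open>\<rho> *\<^sub>R u\<close> moves into \<open>K - B\<close>: the slice of \<open>G\<close> fits beside \<open>K \<inter> B\<close> in the
  slice of \<open>B\<close>, and its shift fits beside \<open>K \<inter> B\<close> in the slice of \<open>K\<close>.\<close>

lemma emeasure_steiner_Int_cball:
  fixes K :: "'a::euclidean_space set"
  assumes K: "compact K" "convex K" and u: "norm u = 1"
  shows "emeasure lborel (K \<inter> cball 0 r) + correlation (K - cball 0 r) (cball 0 r - K) (\<rho> *\<^sub>R u)
    \<le> emeasure lborel (steiner u K \<inter> cball 0 r)"
proof -
  define B :: "'a set" where "B = cball 0 r"
  define S where "S = steiner u K"
  have [measurable]: "K \<in> sets borel" "S \<in> sets borel" "B \<in> sets borel"
    using K compact_steiner[OF K(1) u] by (auto intro: borel_compact simp: S_def B_def)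
  define G where "G = {y. y \<in> B - K \<and> y + \<rho> *\<^sub>R u \<in> K - B}"
  have G[measurable]: "G \<in> sets borel" unfolding G_def by measurable
  have "correlation (K - B) (B - K) (\<rho> *\<^sub>R u) = emeasure lborel G"
    unfolding G_def by (subst correlation_eq_emeasure) (auto intro!: arg_cong[where f="emeasure lborel"])
  then have "emeasure lborel (K \<inter> B) + correlation (K - B) (B - K) (\<rho> *\<^sub>R u)
      = (\<integral>\<^sup>+x. indicator (K \<inter> B) x + indicator G x \<partial>lborel)"
    by (simp add: nn_integral_add)
  also have "\<dots> \<le> (\<integral>\<^sup>+x. indicator (S \<inter> B) x \<partial>lborel)"
  proof (rule nn_integral_mono_along_lines[OF _ _ u])
    fix x :: 'a
    obtain m k where mk: "{t. x + t *\<^sub>R u \<in> K} = {m - k..m + k}"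
      using compact_convex_slice[OF K u] .
    obtain b where b: "{t. x + t *\<^sub>R u \<in> B} = {-(x \<bullet> u) - b..-(x \<bullet> u) + b}"
      using slice_cball[OF u] unfolding B_def .
    define Gx where "Gx = {t. x + t *\<^sub>R u \<in> G}"
    have [measurable]: "Gx \<in> sets borel" unfolding Gx_def by measurable
    define L where "L = emeasure lborel {t. x + t *\<^sub>R u \<in> K \<inter> B} + emeasure lborel Gx"
    have KB[measurable]: "{t. x + t *\<^sub>R u \<in> K \<inter> B} \<in> sets borel" by measurable
    have shift: "x + (t - \<rho>) *\<^sub>R u + \<rho> *\<^sub>R u = x + t *\<^sub>R u" for t by (simp add: algebra_simps)
    have "L = emeasure lborel ({t. x + t *\<^sub>R u \<in> K \<inter> B} \<union> Gx)"
      unfolding L_def by (intro plus_emeasure) (auto simp: Gx_def G_def)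
    also have "\<dots> \<le> emeasure lborel {t. x + t *\<^sub>R u \<in> B}"
      by (intro emeasure_mono) (auto simp: Gx_def G_def)
    finally have Lb: "L \<le> ennreal (2 * b)" unfolding b by (simp add: emeasure_lborel_Icc_ennreal)
    define Gx' where "Gx' = {t. t - \<rho> \<in> Gx}"
    have [measurable]: "Gx' \<in> sets borel" unfolding Gx'_def by measurable
    have "emeasure lborel Gx' = (\<integral>\<^sup>+t. indicator Gx' (t + \<rho>) \<partial>lborel)"
      by (subst nn_integral_translate) auto
    also have "\<dots> = (\<integral>\<^sup>+t. indicator Gx t \<partial>lborel)"
      by (intro nn_integral_cong) (auto simp: Gx'_def indicator_def)
    finally have Gx': "emeasure lborel Gx = emeasure lborel Gx'" by simp
    have Gx'_sub: "t \<in> Gx' \<Longrightarrow> x + t *\<^sub>R u \<in> K - B" for t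
      using shift[of t] by (simp add: Gx'_def Gx_def G_def)
    have "L = emeasure lborel ({t. x + t *\<^sub>R u \<in> K \<inter> B} \<union> Gx')"
      unfolding L_def Gx' using Gx'_sub by (intro plus_emeasure) auto
    also have "\<dots> \<le> emeasure lborel {t. x + t *\<^sub>R u \<in> K}"
      using Gx'_sub by (intro emeasure_mono) auto
    finally have Lk: "L \<le> ennreal (2 * k)" unfolding mk by (simp add: emeasure_lborel_Icc_ennreal)
    have "(\<integral>\<^sup>+t. indicator (K \<inter> B) (x + t *\<^sub>R u) + indicator G (x + t *\<^sub>R u) \<partial>lborel) = L"
      unfolding L_def Gx_def by (simp add: nn_integral_add emeasure_along_lines)
    also have "L \<le> overlap k b 0"
      using Lb Lk unfolding overlap_def by (simp add: min_def)
    also have "\<dots> = emeasure lborel {t. x + t *\<^sub>R u \<in> S \<inter> B}"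
      using emeasure_interval_Int[of "-(x \<bullet> u)" k "-(x \<bullet> u)" b]
      unfolding slice_steiner[OF u mk, folded S_def, symmetric] b[symmetric]
      by (simp add: Collect_conj_eq)
    finally show "(\<integral>\<^sup>+t. indicator (K \<inter> B) (x + t *\<^sub>R u) + indicator G (x + t *\<^sub>R u) \<partial>lborel)
        \<le> (\<integral>\<^sup>+t. indicator (S \<inter> B) (x + t *\<^sub>R u) \<partial>lborel)"
      by (simp add: emeasure_along_lines)
  qed measurable
  also have "\<dots> = emeasure lborel (S \<inter> B)" by simp
  finally show ?thesis by (simp add: B_def S_def)
qed

section \<open>Approximation of the ball\<close>

text \<open>The correlation vanishes for shifts longer than \<open>2 * R\<close> and has total mass \<open>p * q\<close>, so
  it is somewhere at least its average \<open>p * q / V\<close>. Half of the average suffices and spares the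
  discussion of strict inequalities between integrals.\<close>

lemma exists_large_correlation:
  fixes P Q :: "'a::euclidean_space set"
  assumes [measurable]: "P \<in> sets borel" "Q \<in> sets borel"
    and PQ: "P \<subseteq> cball 0 R" "Q \<subseteq> cball 0 R"
    and m: "emeasure lborel P = ennreal p" "emeasure lborel Q = ennreal q" "0 \<le> p" "0 \<le> q"
    and V: "emeasure lborel (cball (0::'a) (2 * R)) = ennreal V" "0 < V"
  shows "\<exists>z. ennreal (p * q / (2 * V)) \<le> correlation P Q z"
proof (rule ccontr)
  define c where "c = p * q / (2 * V)"
  have c: "0 \<le> c" using m V by (simp add: c_def)
  assume "\<not> ?thesis"
  then have less: "correlation P Q z < ennreal c" for z by (simp add: c_def not_le)
  have "ennreal (p * q) = (\<integral>\<^sup>+z. correlation P Q z \<partial>lborel)"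
    using m by (simp add: nn_integral_correlation ennreal_mult)
  also have "\<dots> \<le> (\<integral>\<^sup>+z. ennreal c * indicator (cball (0::'a) (2 * R)) z \<partial>lborel)"
  proof (rule nn_integral_mono)
    fix z :: 'a
    show "correlation P Q z \<le> ennreal c * indicator (cball (0::'a) (2 * R)) z"
      using less[of z] correlation_eq_0[OF PQ, of z] by (cases "norm z \<le> 2 * R") auto
  qed
  also have "\<dots> = ennreal (c * V)"
    using V c by (simp add: nn_integral_cmult_indicator ennreal_mult)
  finally have "p * q \<le> c * V" using c V by (simp add: ennreal_le_iff)
  also have "\<dots> = p * q / 2" using V by (simp add: c_def)
  finally have "p * q \<le> 0" by simp
  then have "c \<le> 0" using V by (simp add: c_def divide_nonpos_pos)
  with less[of 0] show False by (simp add: ennreal_neg)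
qed

text \<open>A shift \<open>z\<close> with large correlation of \<open>K - B\<close> and \<open>B - K\<close> supplies the direction of the
  symmetrization.\<close>

lemma exists_steiner_gain:
  fixes K :: "'a::euclidean_space set"
  assumes K: "compact K" "convex K" "K \<subseteq> cball 0 R" and r: "r \<le> R"
    and vol: "emeasure lborel K = emeasure lborel (cball (0::'a) r)"
    and V: "emeasure lborel (cball (0::'a) (2 * R)) = ennreal V" "0 < V"
  shows "\<exists>u. norm u = 1 \<and> measure lborel (K \<inter> cball 0 r)
      + (measure lborel (cball (0::'a) r) - measure lborel (K \<inter> cball 0 r))\<^sup>2 / (2 * V)
      \<le> measure lborel (steiner u K \<inter> cball 0 r)"
proof -
  define B :: "'a set" where "B = cball 0 r"
  define d where "d = measure lborel B - measure lborel (K \<inter> B)"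
  have B: "compact B" "B \<subseteq> cball 0 R" using r by (auto simp: B_def)
  have [measurable]: "K \<in> sets borel" "B \<in> sets borel"
    using K B by (auto intro: borel_compact)
  have fm: "K \<in> fmeasurable lborel" "B \<in> fmeasurable lborel" "K \<inter> B \<in> fmeasurable lborel"
    using K B by (auto intro!: fmeasurable_compact compact_Int)
  have mK: "measure lborel K = measure lborel B" using vol by (simp add: measure_def B_def)
  have "measure lborel (K - B) = d" "measure lborel (B - K) = d"
    using measure_Un2[of "K \<inter> B" lborel "K - B"] fm mK
      measurable_measure_Diff[of K lborel "K \<inter> B"] measurable_measure_Diff[of B lborel "K \<inter> B"]
    by (auto simp: d_def Diff_Int)
  then have em: "emeasure lborel (K - B) = ennreal d" "emeasure lborel (B - K) = ennreal d"
    using fm by (auto simp: emeasure_eq_measure2 fmeasurable.Diff)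
  have d: "0 \<le> d" unfolding d_def using fm by (auto intro: measure_mono_fmeasurable)
  obtain z where z: "ennreal (d * d / (2 * V)) \<le> correlation (K - B) (B - K) z"
    using exists_large_correlation[of "K - B" "B - K" R d d V] K B em d V by auto
  obtain u \<rho> where u: "norm u = 1" "z = \<rho> *\<^sub>R u"
  proof (cases "z = 0")
    case True
    obtain e :: 'a where "e \<in> Basis" using nonempty_Basis by blast
    then show ?thesis using True that[of e 0] by simp
  next
    case False
    then show ?thesis using that[of "z /\<^sub>R norm z" "norm z"] by simp
  qed
  define S where "S = steiner u K"
  have "compact S" unfolding S_def by (rule compact_steiner[OF K(1) u(1)])
  then have S: "S \<inter> B \<in> fmeasurable lborel"
    using B by (intro fmeasurable_compact compact_Int)
  have "ennreal (measure lborel (K \<inter> B) + d * d / (2 * V))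
      = emeasure lborel (K \<inter> B) + ennreal (d * d / (2 * V))"
    using fm V d by (simp add: emeasure_eq_measure2 ennreal_plus)
  also have "\<dots> \<le> emeasure lborel (K \<inter> B) + correlation (K - B) (B - K) (\<rho> *\<^sub>R u)"
    using z u by (intro add_left_mono) simp
  also have "\<dots> \<le> emeasure lborel (S \<inter> B)"
    unfolding B_def S_def by (rule emeasure_steiner_Int_cball[OF K(1,2) u(1)])
  also have "\<dots> = ennreal (measure lborel (S \<inter> B))" using S by (rule emeasure_eq_measure2)
  finally have "measure lborel (K \<inter> B) + d * d / (2 * V) \<le> measure lborel (S \<inter> B)"
    by (simp add: ennreal_le_iff)
  with u(1) show ?thesis unfolding d_def B_def S_def power2_eq_square by blast
qed

text \<open>The symmetrization step is iterated in the form of a supremum: \<open>\<K>\<close> collects the compact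
  convex subsets of a fixed ball that have the right volume and whose excess is at least that of \<open>K\<close>; it is closed under
  Steiner symmetrization, and the quantitative gain forces the supremum of the overlaps with the ball
  to be the full volume \<open>v\<close> of the ball.\<close>

lemma excess_le_cball:
  fixes K :: "'a::euclidean_space set"
  assumes K: "compact K" "convex K" and s: "s < top"
    and vol: "emeasure lborel K = emeasure lborel (cball (0::'a) r)"
  shows "excess s K \<le> excess s (cball (0::'a) r)"
proof -
  define B :: "'a set" where "B = cball 0 r"
  define v where "v = measure lborel B"
  have fB: "B \<in> fmeasurable lborel"
    unfolding B_def by (intro fmeasurable_compact compact_cball)
  have [measurable]: "B \<in> sets borel" by (simp add: B_def)
  have evol: "emeasure lborel B = ennreal v"
    unfolding v_def using fB by (rule emeasure_eq_measure2)
  have v: "0 \<le> v" by (simp add: v_def)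
  obtain R0 where R0: "K \<subseteq> cball 0 R0"
    using compact_imp_bounded[OF K(1)] by (auto simp: bounded_iff subset_iff)
  define R where "R = max 1 (max r R0)"
  have R: "K \<subseteq> cball 0 R" "r \<le> R" "0 < R" using R0 by (auto simp: R_def)
  define V where "V = measure lborel (cball (0::'a) (2 * R))"
  have V: "emeasure lborel (cball (0::'a) (2 * R)) = ennreal V" "0 < V"
    unfolding V_def using R(3) emeasure_eq_measure2[OF fmeasurable_compact[OF compact_cball]]
    by (blast, simp add: content_cball)
  define \<K> :: "'a set set" where "\<K> = {L. compact L \<and> convex L \<and> L \<subseteq> cball 0 R \<and>
      emeasure lborel L = emeasure lborel B \<and> excess s K \<le> excess s L}"
  have step: "steiner u L \<in> \<K>" if "L \<in> \<K>" "norm u = 1" for L u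
  proof -
    have L: "compact L" "convex L" "L \<subseteq> cball 0 R" "emeasure lborel L = emeasure lborel B"
      "excess s K \<le> excess s L" using that(1) by (auto simp: \<K>_def)
    have "steiner u L \<subseteq> cball 0 R"
      using steiner_mono[OF L(3), of u] steiner_cball[OF that(2), of R] by simp
    moreover have "excess s K \<le> excess s (steiner u L)"
      using L(5) excess_le_steiner[OF L(1,2) that(2) s] by (rule order_trans)
    ultimately show ?thesis
      unfolding \<K>_def using L compact_steiner[OF L(1) that(2)] convex_steiner[OF L(2)]
        emeasure_steiner[OF L(1,2) that(2)] by simp
  qed
  define I where "I L = measure lborel (L \<inter> B)" for L
  have K\<K>: "K \<in> \<K>" using K R vol by (simp add: \<K>_def B_def)
  have \<K>_fm: "L \<in> fmeasurable lborel" if "L \<in> \<K>" for L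
    using that by (auto simp: \<K>_def intro: fmeasurable_compact)
  have I_le: "I L \<le> v" if "L \<in> \<K>" for L
    unfolding I_def v_def using \<K>_fm[OF that] fB by (intro measure_mono_fmeasurable) auto
  have bdd: "bdd_above (I ` \<K>)" using I_le by (intro bdd_aboveI2)
  define m where "m = (SUP L\<in>\<K>. I L)"
  have m_ge: "I L \<le> m" if "L \<in> \<K>" for L
    unfolding m_def using bdd that by (intro cSUP_upper)
  have "m = v"
  proof (rule ccontr)
    assume "m \<noteq> v"
    moreover have "m \<le> v" unfolding m_def using K\<K> I_le by (intro cSUP_least) auto
    ultimately have mv: "m < v" by simp
    then have "m - (v - m)\<^sup>2 / (2 * V) < m" using V by simp
    then obtain L where L: "L \<in> \<K>" "m - (v - m)\<^sup>2 / (2 * V) < I L"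
      using less_cSUP_iff[OF _ bdd] K\<K> unfolding m_def by blast
    then obtain u where u: "norm u = 1"
      "I L + (v - I L)\<^sup>2 / (2 * V) \<le> I (steiner u L)"
      using exists_steiner_gain[of L R r V] R V unfolding \<K>_def I_def v_def B_def by auto
    have "(v - m)\<^sup>2 / (2 * V) \<le> (v - I L)\<^sup>2 / (2 * V)"
      using m_ge[OF L(1)] mv V by (intro divide_right_mono power_mono) auto
    then have "m < I (steiner u L)" using L(2) u(2) by linarith
    with m_ge[OF step[OF L(1) u(1)]] show False by simp
  qed
  show ?thesis
  proof (rule ennreal_le_epsilon)
    fix e :: real assume e: "0 < e"
    define \<epsilon> where "\<epsilon> = e / (2 * v + 1)"
    have \<epsilon>: "0 < \<epsilon>" using e v by (simp add: \<epsilon>_def)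
    then have "v - \<epsilon> < m" using \<open>m = v\<close> by simp
    then obtain L where L: "L \<in> \<K>" "v - \<epsilon> < I L"
      using less_cSUP_iff[OF _ bdd] K\<K> unfolding m_def by blast
    have fL: "L \<in> fmeasurable lborel" by (rule \<K>_fm[OF L(1)])
    have eL: "emeasure lborel L = ennreal v" using L(1) evol by (simp add: \<K>_def)
    then have "measure lborel L = v" using v by (simp add: measure_def)
    then have "measure lborel (L - B) = v - I L"
      using measurable_measure_Diff[of L lborel "L \<inter> B"] fL fB by (auto simp: I_def Diff_Int)
    then have "emeasure lborel (L - B) = ennreal (v - I L)"
      using fL fB by (simp add: emeasure_eq_measure2 fmeasurable.Diff)
    also have "\<dots> \<le> ennreal \<epsilon>" using L(2) by (intro ennreal_leI) simp
    finally have LB: "emeasure lborel (L - B) \<le> ennreal \<epsilon>" .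
    have "excess s K \<le> excess s L" using L(1) by (simp add: \<K>_def)
    also have "\<dots> \<le> excess s B + 2 * (emeasure lborel L * emeasure lborel (L - B))"
      using fL s by (intro excess_le_add_diff) auto
    also have "\<dots> \<le> excess s B + 2 * (ennreal v * ennreal \<epsilon>)"
      unfolding eL using LB by (intro add_left_mono mult_left_mono) auto
    also have "2 * (ennreal v * ennreal \<epsilon>) = ennreal (2 * (v * \<epsilon>))"
      using v \<epsilon> by (simp add: ennreal_mult)
    also have "excess s B + \<dots> \<le> excess s B + ennreal e"
      using v e by (intro add_left_mono ennreal_leI) (simp add: \<epsilon>_def field_simps)
    finally show "excess s K \<le> excess s (cball (0::'a) r) + ennreal e" by (simp add: B_def)
  qed
qed

section \<open>Convolution bodies\<close>

text \<open>A non-decreasing weight is a superposition of indicators of upper sets of \<open>{0..1}\<close>, each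
  of which is empty or agrees with some \<open>{s..1}\<close> up to the point \<open>s\<close>. Hence it suffices to compare tail
  integrals.\<close>

lemma nn_integral_mono_weight:
  fixes \<omega> :: "real \<Rightarrow> real" and F G :: "real \<Rightarrow> ennreal"
  assumes mono: "mono_on {0..1} \<omega>" and nonneg: "\<And>\<delta>. \<delta> \<in> {0..1} \<Longrightarrow> \<omega> \<delta> \<ge> 0"
    and [measurable]: "F \<in> borel_measurable borel" "G \<in> borel_measurable borel"
    and tail: "\<And>s. s \<in> {0..1} \<Longrightarrow> (\<integral>\<^sup>+\<delta>\<in>{s..1}. F \<delta> \<partial>lborel) \<le> (\<integral>\<^sup>+\<delta>\<in>{s..1}. G \<delta> \<partial>lborel)"
  shows "(\<integral>\<^sup>+\<delta>\<in>{0..1}. ennreal (\<omega> \<delta>) * F \<delta> \<partial>lborel) \<le> (\<integral>\<^sup>+\<delta>\<in>{0..1}. ennreal (\<omega> \<delta>) * G \<delta> \<partial>lborel)"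
proof -
  \<comment> \<open>The weight is extended to a monotone function on the whole line, which is therefore measurable.\<close>
  define w where "w \<delta> = \<omega> (max 0 (min 1 \<delta>))" for \<delta>
  have "mono w" unfolding w_def by (intro monoI mono_onD[OF mono]) auto
  then have [measurable]: "w \<in> borel_measurable borel" by (rule borel_measurable_mono)
  define U where "U t = {\<delta> \<in> {0..1}. 0 \<le> t \<and> t < w \<delta>}" for t
  have layer: "(\<integral>\<^sup>+\<delta>\<in>{0..1}. ennreal (\<omega> \<delta>) * H \<delta> \<partial>lborel) = (\<integral>\<^sup>+t. (\<integral>\<^sup>+\<delta>\<in>U t. H \<delta> \<partial>lborel) \<partial>lborel)"
    if [measurable]: "H \<in> borel_measurable borel" for H
  proof -
    have "(\<integral>\<^sup>+\<delta>\<in>{0..1}. ennreal (\<omega> \<delta>) * H \<delta> \<partial>lborel)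
        = (\<integral>\<^sup>+\<delta>. \<integral>\<^sup>+t. (if 0 \<le> t \<and> t < w \<delta> \<and> \<delta> \<in> {0..1} then H \<delta> else 0) \<partial>lborel \<partial>lborel)"
    proof (rule nn_integral_cong)
      fix \<delta> :: real
      show "ennreal (\<omega> \<delta>) * H \<delta> * indicator {0..1} \<delta>
          = (\<integral>\<^sup>+t. (if 0 \<le> t \<and> t < w \<delta> \<and> \<delta> \<in> {0..1} then H \<delta> else 0) \<partial>lborel)"
      proof (cases "\<delta> \<in> {0..1}")
        case True
        then have w: "w \<delta> = \<omega> \<delta>" by (simp add: w_def)
        have "(\<integral>\<^sup>+t. (if 0 \<le> t \<and> t < w \<delta> \<and> \<delta> \<in> {0..1} then H \<delta> else 0) \<partial>lborel)
            = (\<integral>\<^sup>+t. H \<delta> * indicator {0..<\<omega> \<delta>} t \<partial>lborel)"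
          using True by (intro nn_integral_cong) (auto simp: w indicator_def)
        also have "\<dots> = H \<delta> * ennreal (\<omega> \<delta>)"
          using nonneg[OF True] by (simp add: nn_integral_cmult_indicator)
        finally show ?thesis using True by (simp add: mult.commute)
      qed auto
    qed
    also have "\<dots> = (\<integral>\<^sup>+t. \<integral>\<^sup>+\<delta>. (if 0 \<le> t \<and> t < w \<delta> \<and> \<delta> \<in> {0..1} then H \<delta> else 0) \<partial>lborel \<partial>lborel)"
      by (rule lborel_pair.Fubini'[symmetric]) measurable
    also have "\<dots> = (\<integral>\<^sup>+t. (\<integral>\<^sup>+\<delta>\<in>U t. H \<delta> \<partial>lborel) \<partial>lborel)"
      by (intro nn_integral_cong) (auto simp: U_def indicator_def)
    finally show ?thesis .
  qed
  have "(\<integral>\<^sup>+\<delta>\<in>U t. F \<delta> \<partial>lborel) \<le> (\<integral>\<^sup>+\<delta>\<in>U t. G \<delta> \<partial>lborel)" for t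
  proof (cases "U t = {}")
    case False
    define s where "s = Inf (U t)"
    have bdd: "bdd_below (U t)" by (rule bdd_belowI[of _ 0]) (auto simp: U_def)
    have U01: "U t \<subseteq> {0..1}" by (auto simp: U_def)
    obtain \<delta>0 where "\<delta>0 \<in> U t" using False by blast
    then have "s \<le> 1" using cInf_lower[OF _ bdd, of \<delta>0] U01 unfolding s_def by force
    moreover have "0 \<le> s" unfolding s_def using False U01 by (intro cInf_greatest) auto
    ultimately have s: "s \<in> {0..1}" by simp
    have mem: "\<delta> \<in> U t \<longleftrightarrow> \<delta> \<in> {s..1}" if "\<delta> \<noteq> s" for \<delta>
    proof
      assume "\<delta> \<in> U t"
      then show "\<delta> \<in> {s..1}" using cInf_lower[OF _ bdd, of \<delta>] U01 unfolding s_def by auto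
    next
      assume \<delta>: "\<delta> \<in> {s..1}"
      then have "s < \<delta>" using that by simp
      then obtain \<eta> where \<eta>: "\<eta> \<in> U t" "\<eta> < \<delta>"
        using cInf_less_iff[OF False bdd] unfolding s_def by blast
      have "w \<eta> \<le> w \<delta>" using \<open>mono w\<close> \<eta>(2) by (simp add: monoD)
      then show "\<delta> \<in> U t" using \<eta> \<delta> s by (auto simp: U_def)
    qed
    have "(\<integral>\<^sup>+\<delta>\<in>U t. H \<delta> \<partial>lborel) = (\<integral>\<^sup>+\<delta>\<in>{s..1}. H \<delta> \<partial>lborel)" for H :: "real \<Rightarrow> ennreal"
      by (rule nn_integral_cong_AE, rule AE_mp[OF AE_lborel_singleton[of s]])
         (simp add: mem indicator_def)
    then show ?thesis using tail[OF s] by simp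
  qed simp
  then show ?thesis unfolding layer[OF assms(3)] layer[OF assms(4)] by (rule nn_integral_mono)
qed

lemma correlation_self_eq_measure:
  fixes K :: "(real ^ 'n) set"
  assumes K: "compact K"
  shows "correlation K K x = ennreal (measure lebesgue (K \<inter> (\<lambda>y. y + x) ` K))"
proof -
  have [measurable]: "K \<in> sets borel" using K by (rule borel_compact)
  have C: "compact (K \<inter> (\<lambda>y. y + x) ` K)"
    by (intro compact_Int compact_continuous_image continuous_intros K)
  have mem: "y \<in> K \<inter> (\<lambda>y. y + x) ` K \<longleftrightarrow> y \<in> K \<and> y - x \<in> K" for y
    by (auto simp: image_iff) (metis diff_add_cancel)
  have "correlation K K x = (\<integral>\<^sup>+y. indicator K (y + x) * indicator K (y + x - x) \<partial>lborel)"
    by (simp add: correlation_def)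
  also have "\<dots> = (\<integral>\<^sup>+y. indicator K y * indicator K (y - x) \<partial>lborel)"
    by (rule nn_integral_translate[of "\<lambda>y. indicator K y * indicator K (y - x)"]) measurable
  also have "\<dots> = (\<integral>\<^sup>+y. indicator (K \<inter> (\<lambda>y. y + x) ` K) y \<partial>lborel)"
    by (intro nn_integral_cong) (simp add: indicator_def mem[unfolded Int_iff] )
  also have "\<dots> = emeasure lborel (K \<inter> (\<lambda>y. y + x) ` K)"
    using borel_compact[OF C] by simp
  also have "\<dots> = ennreal (measure lborel (K \<inter> (\<lambda>y. y + x) ` K))"
    by (intro emeasure_eq_measure2 fmeasurable_compact C)
  finally show ?thesis using borel_compact[OF C] by simp
qed

lemma convolution_body_eq:
  fixes K :: "(real ^ 'n) set"
  assumes K: "compact K"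
  shows "convolution_body \<delta> K = {x. ennreal (\<delta> * measure lebesgue K) \<le> correlation K K x}"
  unfolding convolution_body_def correlation_self_eq_measure[OF K] by (simp add: ennreal_le_iff)

lemma convolution_body_borel:
  fixes K :: "(real ^ 'n) set"
  assumes K: "compact K"
  shows "convolution_body \<delta> K \<in> sets borel"
proof -
  have [measurable]: "K \<in> sets borel" using K by (rule borel_compact)
  show ?thesis unfolding convolution_body_eq[OF K] by measurable
qed

lemma measurable_emeasure_convolution_body:
  fixes K :: "(real ^ 'n) set"
  assumes K: "compact K"
  shows "(\<lambda>\<delta>. emeasure lebesgue (convolution_body \<delta> K)) \<in> borel_measurable borel"
proof -
  have [measurable]: "K \<in> sets borel" using K by (rule borel_compact)
  have "emeasure lebesgue (convolution_body \<delta> K) = (\<integral>\<^sup>+x. (if ennreal (\<delta> * measure lebesgue K)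
      \<le> correlation K K x then 1 else 0) \<partial>lborel)" for \<delta>
  proof -
    have "emeasure lebesgue (convolution_body \<delta> K) = (\<integral>\<^sup>+x. indicator (convolution_body \<delta> K) x \<partial>lborel)"
      using convolution_body_borel[OF K] by simp
    then show ?thesis by (simp add: convolution_body_eq[OF K] indicator_def of_bool_def)
  qed
  then show ?thesis by simp
qed

text \<open>By Tonelli the integral over \<open>\<delta>\<close> of the volumes of the superlevel sets is the integral over \<open>x\<close>
  of the length of \<open>{s..c / V}\<close>, where \<open>c\<close> is the value of the covariogram at \<open>x\<close>. The cutoff
  \<open>\<delta> \<le> 1\<close> is harmless because \<open>c \<le> V\<close>.\<close>

lemma nn_integral_convolution_body_tail:
  fixes K :: "(real ^ 'n) set"
  assumes K: "compact K" and V: "measure lebesgue K > 0" and s: "0 \<le> s"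
  shows "(\<integral>\<^sup>+\<delta>\<in>{s..1}. emeasure lebesgue (convolution_body \<delta> K) \<partial>lborel)
    = ennreal (1 / measure lebesgue K) * excess (ennreal (s * measure lebesgue K)) K"
proof -
  define V where "V = measure lebesgue K"
  have V0: "0 < V" using V by (simp add: V_def)
  have [measurable]: "K \<in> sets borel" using K by (rule borel_compact)
  have "(\<integral>\<^sup>+\<delta>\<in>{s..1}. emeasure lebesgue (convolution_body \<delta> K) \<partial>lborel)
      = (\<integral>\<^sup>+\<delta>. \<integral>\<^sup>+x. (if s \<le> \<delta> \<and> \<delta> \<le> 1 \<and> ennreal (\<delta> * V) \<le> correlation K K x then 1 else 0) \<partial>lborel \<partial>lborel)"
  proof (rule nn_integral_cong)
    fix \<delta> :: real
    have "emeasure lebesgue (convolution_body \<delta> K) = (\<integral>\<^sup>+x. indicator (convolution_body \<delta> K) x \<partial>lborel)"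
      using convolution_body_borel[OF K] by simp
    then show "emeasure lebesgue (convolution_body \<delta> K) * indicator {s..1} \<delta>
      = (\<integral>\<^sup>+x. (if s \<le> \<delta> \<and> \<delta> \<le> 1 \<and> ennreal (\<delta> * V) \<le> correlation K K x then 1 else 0) \<partial>lborel)"
      by (auto simp: convolution_body_eq[OF K] indicator_def of_bool_def V_def)
  qed
  also have "\<dots> = (\<integral>\<^sup>+x. \<integral>\<^sup>+\<delta>. (if s \<le> \<delta> \<and> \<delta> \<le> 1 \<and> ennreal (\<delta> * V) \<le> correlation K K x then 1 else 0) \<partial>lborel \<partial>lborel)"
    by (rule lborel_pair.Fubini'[symmetric]) measurable
  also have "\<dots> = (\<integral>\<^sup>+x. ennreal (1 / V) * (correlation K K x - ennreal (s * V)) \<partial>lborel)"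
  proof (rule nn_integral_cong)
    fix x :: "real ^ 'n"
    define c where "c = measure lebesgue (K \<inter> (\<lambda>y. y + x) ` K)"
    have c: "correlation K K x = ennreal c" "0 \<le> c"
      using correlation_self_eq_measure[OF K] by (auto simp: c_def)
    have "correlation K K x \<le> (\<integral>\<^sup>+y. indicator K y \<partial>lborel)"
      unfolding correlation_def by (intro nn_integral_mono) (auto simp: indicator_def)
    also have "\<dots> = ennreal V"
      unfolding V_def using emeasure_eq_measure2[OF fmeasurable_compact[OF K]] by simp
    finally have cV: "c \<le> V" using c V0 by (simp add: ennreal_le_iff)
    have "s \<le> \<delta> \<and> \<delta> \<le> 1 \<and> ennreal (\<delta> * V) \<le> correlation K K x \<longleftrightarrow> \<delta> \<in> {s..c / V}" for \<delta>
    proof -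
      have "ennreal (\<delta> * V) \<le> correlation K K x \<longleftrightarrow> \<delta> \<le> c / V"
        using c V0 by (simp add: ennreal_le_iff pos_le_divide_eq)
      moreover have "c / V \<le> 1" using cV V0 by simp
      ultimately show ?thesis by auto
    qed
    then have "(\<integral>\<^sup>+\<delta>. (if s \<le> \<delta> \<and> \<delta> \<le> 1 \<and> ennreal (\<delta> * V) \<le> correlation K K x then 1 else 0) \<partial>lborel)
        = (\<integral>\<^sup>+\<delta>. indicator {s..c / V} \<delta> \<partial>lborel)"
      by (simp add: indicator_def of_bool_def)
    also have "\<dots> = ennreal (c / V - s)" by (simp add: emeasure_lborel_Icc_ennreal)
    also have "c / V - s = 1 / V * (c - s * V)" using V0 by (simp add: field_simps)
    also have "ennreal \<dots> = ennreal (1 / V) * (correlation K K x - ennreal (s * V))"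
      unfolding c(1) using V0 s by (simp add: ennreal_minus flip: ennreal_mult')
    finally show "(\<integral>\<^sup>+\<delta>. (if s \<le> \<delta> \<and> \<delta> \<le> 1 \<and> ennreal (\<delta> * V) \<le> correlation K K x then 1 else 0) \<partial>lborel)
        = ennreal (1 / V) * (correlation K K x - ennreal (s * V))" .
  qed
  also have "\<dots> = ennreal (1 / V) * excess (ennreal (s * V)) K"
    unfolding excess_def by (rule nn_integral_cmult) measurable
  finally show ?thesis by (simp add: V_def)
qed

theorem theorem1p1:
  fixes \<omega> :: "real \<Rightarrow> real" and K :: "(real ^ 'n) set"
  assumes "mono_on {0..1} \<omega>"
    and "\<And>\<delta>. \<delta> \<in> {0..1} \<Longrightarrow> \<omega> \<delta> \<ge> 0"
    and "convex_body K"
  shows "(\<integral>\<^sup>+\<delta>\<in>{0..1}. ennreal (\<omega> \<delta>) * emeasure lebesgue (convolution_body \<delta> K) \<partial>lebesgue)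
    \<le> (\<integral>\<^sup>+\<delta>\<in>{0..1}. ennreal (\<omega> \<delta>) * emeasure lebesgue (convolution_body \<delta> (volume_ball K)) \<partial>lebesgue)"
proof -
  have K: "compact K" "convex K" "interior K \<noteq> {}"
    using assms(3) by (auto simp: convex_body_def)
  have [measurable]: "K \<in> sets borel" using K(1) by (rule borel_compact)
  have fin: "emeasure lebesgue K < \<infinity>"
    using emeasure_compact_finite[OF K(1)] by simp
  obtain r where B: "volume_ball K = cball 0 r" "emeasure lebesgue (volume_ball K) = emeasure lebesgue K"
    using theI'[OF volume_ball_unique[OF fin]] unfolding volume_ball_def[symmetric] by blast
  have vol: "emeasure lborel K = emeasure lborel (cball (0 :: real ^ 'n) r)"
    using B by simp
  have mvol: "measure lebesgue (cball (0 :: real ^ 'n) r) = measure lebesgue K"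
    using B by (simp add: measure_def)
  have pos: "measure lebesgue K > 0"
  proof -
    obtain x e where e: "0 < e" "ball x e \<subseteq> K"
      using K(3) mem_interior by blast
    have "0 < measure lebesgue (ball x e)" using e(1) by (simp add: content_ball_pos)
    also have "\<dots> \<le> measure lebesgue K"
      using e(2) lmeasurable_compact[OF K(1)] by (intro measure_mono_fmeasurable) auto
    finally show ?thesis .
  qed
  show ?thesis unfolding B(1) nn_integral_completion
  proof (rule nn_integral_mono_weight[OF assms(1,2)])
    fix s :: real assume "s \<in> {0..1}"
    then have s: "0 \<le> s" by simp
    show "(\<integral>\<^sup>+\<delta>\<in>{s..1}. emeasure lebesgue (convolution_body \<delta> K) \<partial>lborel)
      \<le> (\<integral>\<^sup>+\<delta>\<in>{s..1}. emeasure lebesgue (convolution_body \<delta> (cball (0 :: real ^ 'n) r)) \<partial>lborel)"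
      unfolding nn_integral_convolution_body_tail[OF K(1) pos s]
        nn_integral_convolution_body_tail[OF compact_cball pos[folded mvol] s] mvol
      by (intro mult_left_mono excess_le_cball[OF K(1,2) _ vol]) auto
  qed (assumption | intro measurable_emeasure_convolution_body K compact_cball)+
qed

end
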